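(* Let $R$ be a finite ring generated by the identity element or the ring of integers, and let $M_n(R)$ be the ring of $n\times n$ matrices over $R$, $n>1$. Then for every local inner derivation $\nabla$ on the ring $M_n(R)$ there exists a matrix $a\in M_n(R)$ such that $\nabla(x)=ax-xa$ for all $x\in M_n(R)$; that is, $\nabla$ is a derivation.
   Context: A finite ring generated by the identity element is a ring with identity having finitely many elements, every element of which is a sum of some number of copies of the identity element. For an associative ring $\mathcal{R}$, a derivation is an additive map $D:\mathcal{R}\to\mathcal{R}$ with $D(xy)=D(x)y+xD(y)$ for all $x,y$; for $a\in\mathcal{R}$ the map $D_a(x)=ax-xa$ is called an inner derivation. An additive map $\nabla:\mathcal{R}\to\mathcal{R}$ is called a local inner derivation if for every $x\in\mathcal{R}$ there exists $a\in\mathcal{R}$ (depending on $x$) such that $\nabla(x)=D_a(x)$. *)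

theory Defs
  imports "Jordan_Normal_Form.Matrix"
begin

text \<open>
  A ring with identity is a type of sort \<open>{ring, monoid_mult}\<close>. This is \<open>ring_1\<close> without the
  axiom \<open>0 \<noteq> 1\<close>, so that the zero ring is not excluded; \<open>of_nat\<close> is not available at this sort,
  hence the explicit sum of copies of \<open>1\<close> below.
\<close>

definition finite_ring_generated_by_one :: "'a::{ring, monoid_mult} itself \<Rightarrow> bool" where
  "finite_ring_generated_by_one _ \<longleftrightarrow>
     finite (UNIV :: 'a set) \<and> (\<forall>x::'a. \<exists>k::nat. x = (\<Sum>i<k. 1))"

definition ring_of_integers :: "'a::{ring, monoid_mult} itself \<Rightarrow> bool" where
  "ring_of_integers _ \<longleftrightarrow>
     (\<exists>f :: 'a \<Rightarrow> int. bij f \<and> f 1 = 1 \<and>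
        (\<forall>x y. f (x + y) = f x + f y) \<and> (\<forall>x y. f (x * y) = f x * f y))"

lemma ring_of_integers_int: "ring_of_integers TYPE(int)"
  unfolding ring_of_integers_def by (rule exI[of _ id]) simp

text \<open>
  The type \<open>'a mat\<close> contains matrices of all dimensions, so the following notions are relative to
  a set \<open>S\<close>, the carrier of the associative ring in question. They are applied to
  \<open>S = carrier_mat n n\<close>; the values of a map outside \<open>S\<close> are irrelevant.
\<close>

definition additive_on :: "'b::plus set \<Rightarrow> ('b \<Rightarrow> 'b) \<Rightarrow> bool" where
  "additive_on S f \<longleftrightarrow> f \<in> S \<rightarrow> S \<and> (\<forall>x\<in>S. \<forall>y\<in>S. f (x + y) = f x + f y)"

definition derivation_on :: "'b::{plus, times} set \<Rightarrow> ('b \<Rightarrow> 'b) \<Rightarrow> bool" where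
  "derivation_on S D \<longleftrightarrow>
     additive_on S D \<and> (\<forall>x\<in>S. \<forall>y\<in>S. D (x * y) = D x * y + x * D y)"

definition inner_derivation :: "'b::{minus, times} \<Rightarrow> 'b \<Rightarrow> 'b" where
  "inner_derivation a x = a * x - x * a"

definition local_inner_derivation_on :: "'b::{plus, minus, times} set \<Rightarrow> ('b \<Rightarrow> 'b) \<Rightarrow> bool" where
  "local_inner_derivation_on S \<Delta> \<longleftrightarrow>
     additive_on S \<Delta> \<and> (\<forall>x\<in>S. \<exists>a\<in>S. \<Delta> x = inner_derivation a x)"

end

theory Submission
  imports Defs
begin

text \<open>
  Write \<open>[x, y] = x y - y x\<close>. The proof turns \<open>\<Delta>\<close> into the biadditive form
  \<open>B x y = tr (\<Delta> x \<cdot> y)\<close>. If \<open>x\<close> and \<open>y\<close> commute and \<open>\<Delta> x = [a, x]\<close>, then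
  \<open>B x y = tr ([a, x] y) = tr (a [x, y]) = 0\<close>, whatever the matrix \<open>a\<close> that belongs to \<open>x\<close> is.
  Thus the unknown dependence of \<open>a\<close> on \<open>x\<close> disappears, and all that remains of the local
  hypothesis is that \<open>B\<close> vanishes on commuting pairs.

  On matrix units this is already enough to force \<open>B x y = \<phi> [x, y]\<close> for an additive \<open>\<phi>\<close>
  (matrix rings are ``zero Lie product determined''): a few commuting pairs built from matrix
  units show that the value of \<open>B\<close> on a pair of matrix units depends only on their commutator
  (\<open>units_form\<close>). The commutative ring \<open>R\<close> allows \<open>\<phi>\<close> to be written as \<open>z \<mapsto> tr (a z)\<close>, and
  reading off entries, which are the values \<open>B x e\<^sub>k\<^sub>l\<close>, gives \<open>\<Delta> x = [a, x]\<close> for every matrix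
  unit \<open>x\<close>, now with a single \<open>a\<close> (\<open>local_inner_derivation_inner_on_units\<close>).

  Both sides of this equation are additive in \<open>x\<close>. Both kinds of ring in question consist of
  integer multiples of \<open>1\<close>, so that the matrix units generate \<open>M\<^sub>n(R)\<close> as an additive group and
  the equation extends to all matrices (\<open>additive_on_mat_eqI\<close>). The same description of \<open>R\<close>
  gives its commutativity, which the cyclic invariance of the trace rests on.
\<close>

section \<open>Matrix units and the trace\<close>

definition matrix_unit :: "nat \<Rightarrow> nat \<Rightarrow> nat \<Rightarrow> 'a::{zero, one} mat" where
  "matrix_unit n i j = mat n n (\<lambda>(k, l). if k = i \<and> l = j then 1 else 0)"

lemma matrix_unit_carrier [simp, intro]: "matrix_unit n i j \<in> carrier_mat n n"
  by (simp add: matrix_unit_def)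

lemma index_mult_matrix_unit:
  fixes A :: "'a::{ring, monoid_mult} mat"
  assumes "A \<in> carrier_mat n n" "k < n" "l < n" "i < n"
  shows "(A * matrix_unit n i j) $$ (k, l) = (if l = j then A $$ (k, i) else 0)"
proof -
  have "(A * matrix_unit n i j) $$ (k, l)
      = (\<Sum>p = 0..<n. A $$ (k, p) * (if p = i \<and> l = j then 1 else 0))"
    using assms by (auto simp: matrix_unit_def scalar_prod_def intro!: sum.cong)
  also have "\<dots> = (\<Sum>p = 0..<n. if p = i then (if l = j then A $$ (k, i) else 0) else 0)"
    by (intro sum.cong) auto
  finally show ?thesis using assms by simp
qed

lemma index_matrix_unit_mult:
  fixes A :: "'a::{ring, monoid_mult} mat"
  assumes "A \<in> carrier_mat n n" "k < n" "l < n" "j < n"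
  shows "(matrix_unit n i j * A) $$ (k, l) = (if k = i then A $$ (j, l) else 0)"
proof -
  have "(matrix_unit n i j * A) $$ (k, l)
      = (\<Sum>p = 0..<n. (if k = i \<and> p = j then 1 else 0) * A $$ (p, l))"
    using assms by (auto simp: matrix_unit_def scalar_prod_def intro!: sum.cong)
  also have "\<dots> = (\<Sum>p = 0..<n. if p = j then (if k = i then A $$ (j, l) else 0) else 0)"
    by (intro sum.cong) auto
  finally show ?thesis using assms by simp
qed

lemma matrix_unit_mult:
  fixes i j k l n :: nat
  assumes "i < n" "j < n" "k < n" "l < n"
  shows "(matrix_unit n i j :: 'a::{ring, monoid_mult} mat) * matrix_unit n k l
    = (if j = k then matrix_unit n i l else 0\<^sub>m n n)"
proof (rule eq_matI)
  fix p q
  assume "p < dim_row (if j = k then matrix_unit n i l else 0\<^sub>m n n :: 'a mat)"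
    and "q < dim_col (if j = k then matrix_unit n i l else 0\<^sub>m n n :: 'a mat)"
  then have "p < n" "q < n"
    by (auto simp: matrix_unit_def split: if_splits)
  then show "((matrix_unit n i j :: 'a mat) * matrix_unit n k l) $$ (p, q)
      = (if j = k then matrix_unit n i l else 0\<^sub>m n n) $$ (p, q)"
    using assms by (simp add: index_mult_matrix_unit) (auto simp: matrix_unit_def)
qed (auto simp: matrix_unit_def)

definition mat_trace :: "'a::comm_monoid_add mat \<Rightarrow> 'a" where
  "mat_trace A = (\<Sum>i<dim_row A. A $$ (i, i))"

lemma mat_trace_add:
  assumes "A \<in> carrier_mat n n" "B \<in> carrier_mat n n"
  shows "mat_trace (A + B) = mat_trace A + mat_trace B"
  using assms by (simp add: mat_trace_def sum.distrib)

lemma mat_trace_minus: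
  fixes A :: "'a::ab_group_add mat"
  assumes "A \<in> carrier_mat n n" "B \<in> carrier_mat n n"
  shows "mat_trace (A - B) = mat_trace A - mat_trace B"
  using assms by (simp add: mat_trace_def sum_subtractf)

lemma mat_trace_mult_commute:
  fixes A :: "'a::ring mat"
  assumes comm: "\<And>r s :: 'a. r * s = s * r"
    and "A \<in> carrier_mat n n" "B \<in> carrier_mat n n"
  shows "mat_trace (A * B) = mat_trace (B * A)"
proof -
  have "mat_trace (A * B) = (\<Sum>i<n. \<Sum>p<n. A $$ (i, p) * B $$ (p, i))"
    using assms(2,3) by (simp add: mat_trace_def scalar_prod_def atLeast0LessThan)
  also have "\<dots> = (\<Sum>p<n. \<Sum>i<n. B $$ (p, i) * A $$ (i, p))"
    by (subst sum.swap) (simp add: comm)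
  also have "\<dots> = mat_trace (B * A)"
    using assms(2,3) by (simp add: mat_trace_def scalar_prod_def atLeast0LessThan)
  finally show ?thesis .
qed

text \<open>
  The trace pairing with matrix units recovers every entry of a matrix, so passing from \<open>\<Delta>\<close> to
  the form \<open>tr (\<Delta> x \<cdot> y)\<close> loses no information.
\<close>
lemma mat_trace_mult_matrix_unit:
  fixes A :: "'a::{ring, monoid_mult} mat"
  assumes "A \<in> carrier_mat n n" "k < n" "l < n"
  shows "mat_trace (A * matrix_unit n k l) = A $$ (l, k)"
proof -
  have "mat_trace (A * matrix_unit n k l) = (\<Sum>i<n. if i = l then A $$ (l, k) else 0)"
    unfolding mat_trace_def
    using assms by (intro sum.cong) (auto simp: index_mult_matrix_unit simp del: index_mult_mat(1))
  then show ?thesis using assms by simp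
qed

text \<open>
  By cyclic invariance the left-hand side is \<open>tr (a (x y - y x))\<close>. It is this cancellation that
  removes the matrix \<open>a\<close> from the local condition.
\<close>
lemma mat_trace_commutator_mult:
  fixes a x y :: "'a::ring mat"
  assumes comm: "\<And>r s :: 'a. r * s = s * r"
    and a: "a \<in> carrier_mat n n" and x: "x \<in> carrier_mat n n" and y: "y \<in> carrier_mat n n"
    and xy: "x * y = y * x"
  shows "mat_trace ((a * x - x * a) * y) = 0"
proof -
  have "mat_trace ((a * x - x * a) * y) = mat_trace (a * x * y) - mat_trace (x * a * y)"
    using a x y by (simp add: minus_mult_distrib_mat[of _ n n] mat_trace_minus[of _ n])
  also have "x * a * y = x * (a * y)"
    using a x y by simp
  also have "mat_trace (x * (a * y)) = mat_trace (a * y * x)"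
    using a x y by (intro mat_trace_mult_commute[of _ n] comm) auto
  also have "a * y * x = a * x * y"
    using a x y xy by simp
  finally show ?thesis by simp
qed

section \<open>Biadditive forms that vanish on commuting pairs\<close>

locale lie_null_form =
  fixes n :: nat and B :: "'a::{ring, monoid_mult} mat \<Rightarrow> 'a mat \<Rightarrow> 'b::ab_group_add"
  assumes add_left: "\<lbrakk>x \<in> carrier_mat n n; y \<in> carrier_mat n n; z \<in> carrier_mat n n\<rbrakk>
      \<Longrightarrow> B (x + y) z = B x z + B y z"
    and add_right: "\<lbrakk>x \<in> carrier_mat n n; y \<in> carrier_mat n n; z \<in> carrier_mat n n\<rbrakk>
      \<Longrightarrow> B x (y + z) = B x y + B x z"
    and null: "\<lbrakk>x \<in> carrier_mat n n; y \<in> carrier_mat n n; x * y = y * x\<rbrakk> \<Longrightarrow> B x y = 0"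
begin

abbreviation e :: "nat \<Rightarrow> nat \<Rightarrow> 'a mat" where
  "e \<equiv> matrix_unit n"

lemma skew:
  assumes "x \<in> carrier_mat n n" "y \<in> carrier_mat n n"
  shows "B x y = - B y x"
proof -
  have "0 = B (x + y) (x + y)"
    using assms by (simp add: null)
  also have "\<dots> = B x y + B y x"
    using assms by (simp add: add_left add_right null[of x x] null[of y y])
  finally show ?thesis
    by (metis eq_neg_iff_add_eq_0)
qed

lemma diff_right:
  assumes "x \<in> carrier_mat n n" "y \<in> carrier_mat n n" "z \<in> carrier_mat n n"
  shows "B x (y - z) = B x y - B x z"
proof -
  have "y - z + z = y"
    using assms by (intro eq_matI) auto
  then show ?thesis
    using add_right[of x "y - z" z] assms by (simp add: eq_diff_eq minus_carrier_mat)
qed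

lemma units_orthogonal:
  assumes "i < n" "j < n" "k < n" "l < n" "j \<noteq> k" "l \<noteq> i"
  shows "B (e i j) (e k l) = 0"
  using assms by (intro null) (auto simp: matrix_unit_mult)

text \<open>
  Both pairs have the commutator \<open>e\<^sub>i\<^sub>l\<close>. The difference of the two values is the value of \<open>B\<close> on
  \<open>e\<^sub>i\<^sub>j + e\<^sub>i\<^sub>k\<close> and \<open>e\<^sub>j\<^sub>l - e\<^sub>k\<^sub>l\<close>, which commute because their product is zero in either order.
\<close>
lemma units_independent_of_middle:
  assumes "i < n" "j < n" "k < n" "l < n" "l \<noteq> i"
  shows "B (e i j) (e j l) = B (e i k) (e k l)"
proof (cases "j = k")
  case False
  have "(e i j + e i k) * (e j l - e k l) = 0\<^sub>m n n"
    using assms False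
    by (simp add: mult_minus_distrib_mat[of _ n n _ n] add_mult_distrib_mat[of _ n n _ _ n]
        matrix_unit_mult)
  moreover have "(e j l - e k l) * (e i j + e i k) = 0\<^sub>m n n"
    using assms False
    by (simp add: mult_add_distrib_mat[of _ n n _ n] minus_mult_distrib_mat[of _ n n _ _ n]
        matrix_unit_mult)
  ultimately have "B (e i j + e i k) (e j l - e k l) = 0"
    by (intro null) (auto simp: minus_carrier_mat)
  then show ?thesis
    using assms False by (simp add: diff_right add_left units_orthogonal)
qed simp

text \<open>
  The commutator of \<open>e\<^sub>i\<^sub>j\<close> and \<open>e\<^sub>j\<^sub>i\<close> is \<open>e\<^sub>i\<^sub>i - e\<^sub>j\<^sub>j\<close>, so the value of \<open>B\<close> on this pair should be a
  difference of a term in \<open>i\<close> and a term in \<open>j\<close>, and the lemma provides one for each choice of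
  \<open>k\<close>. For distinct indices it is the vanishing of \<open>B\<close> on the cyclic permutation matrix
  \<open>e\<^sub>i\<^sub>j + e\<^sub>j\<^sub>k + e\<^sub>k\<^sub>i\<close> and its square.
\<close>
lemma units_cocycle:
  assumes "i < n" "j < n" "k < n"
  shows "B (e i j) (e j i) = B (e i k) (e k i) - B (e j k) (e k j)"
proof -
  consider "i = j" | "i = k" | "j = k" | "i \<noteq> j" "i \<noteq> k" "j \<noteq> k" by blast
  then show ?thesis
  proof cases
    case 4
    let ?x = "e i j + e j k + e k i"
    have sq: "?x * ?x = e k j + e i k + e j i"
      using assms 4
      by (simp add: add_mult_distrib_mat[of _ n n _ _ n] mult_add_distrib_mat[of _ n n _ n]
          matrix_unit_mult)
    have "B ?x (?x * ?x) = 0"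
      by (intro null mult_carrier_mat[of _ n n _ n] assoc_mult_mat[symmetric, of _ n n _ n _ n]) auto
    then have "B (e j k) (e k j) + B (e k i) (e i k) + B (e i j) (e j i) = 0"
      unfolding sq using assms 4
      by (simp add: add_left add_right units_orthogonal)
    then show ?thesis
      using skew[of "e k i" "e i k"] by (simp add: algebra_simps)
  qed (use assms skew[of "e i j" "e j i"] null in auto)
qed

text \<open>
  \<open>coeff i l\<close> is \<open>\<phi> e\<^sub>i\<^sub>l\<close> for a map \<open>\<phi>\<close> with \<open>B x y = \<phi> [x, y]\<close> on matrix units. On the diagonal
  \<open>\<phi>\<close> is only determined up to a common constant; the index \<open>0\<close> in place of \<open>k\<close> in
  \<open>units_cocycle\<close> normalises it to \<open>\<phi> e\<^sub>0\<^sub>0 = 0\<close>.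
\<close>
definition coeff :: "nat \<Rightarrow> nat \<Rightarrow> 'b" where
  "coeff i l = (if i = l then B (e i 0) (e 0 i) else B (e i i) (e i l))"

text \<open>
  The right-hand side is \<open>\<phi> [e\<^sub>i\<^sub>j, e\<^sub>k\<^sub>l]\<close>, since the commutator is
  \<open>\<delta>\<^sub>j\<^sub>k e\<^sub>i\<^sub>l - \<delta>\<^sub>l\<^sub>i e\<^sub>k\<^sub>j\<close>.
\<close>
lemma units_form:
  assumes "i < n" "j < n" "k < n" "l < n"
  shows "B (e i j) (e k l)
    = (if j = k then coeff i l else 0) - (if l = i then coeff k j else 0)"
proof -
  have "0 < n" using assms by simp
  consider "j \<noteq> k" "l \<noteq> i" | "j = k" "l \<noteq> i" | "j \<noteq> k" "l = i" | "j = k" "l = i" by blast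
  then show ?thesis
  proof cases
    case 1
    then show ?thesis using assms by (simp add: units_orthogonal)
  next
    case 2
    then show ?thesis
      using assms units_independent_of_middle[of i j i l] by (simp add: coeff_def)
  next
    case 3
    then show ?thesis
      using assms units_independent_of_middle[of k i k j] skew[of "e i j" "e k i"]
      by (simp add: coeff_def)
  next
    case 4
    then show ?thesis
      using assms \<open>0 < n\<close> units_cocycle[of i j 0] by (simp add: coeff_def)
  qed
qed

end

section \<open>Commutators with a fixed matrix\<close>

lemma commutator_add_right:
  fixes a :: "'a::ring mat"
  assumes a: "a \<in> carrier_mat n n" and x: "x \<in> carrier_mat n n" and y: "y \<in> carrier_mat n n"
  shows "a * (x + y) - (x + y) * a = (a * x - x * a) + (a * y - y * a)"
proof -
  have "a * (x + y) = a * x + a * y" "(x + y) * a = x * a + y * a"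
    using a x y by (simp_all add: mult_add_distrib_mat[of _ n n _ n] add_mult_distrib_mat[of _ n n _ _ n])
  then show ?thesis
    using a x y by (intro eq_matI) auto
qed

lemma commutator_leibniz:
  fixes a :: "'a::ring mat"
  assumes a: "a \<in> carrier_mat n n" and x: "x \<in> carrier_mat n n" and y: "y \<in> carrier_mat n n"
  shows "a * (x * y) - (x * y) * a = (a * x - x * a) * y + x * (a * y - y * a)"
proof -
  have "(a * x - x * a) * y = a * (x * y) - x * (a * y)"
    using a x y by (simp add: minus_mult_distrib_mat[of _ n n _ _ n] assoc_mult_mat[of _ n n _ n _ n])
  moreover have "x * (a * y - y * a) = x * (a * y) - (x * y) * a"
    using a x y by (simp add: mult_minus_distrib_mat[of _ n n _ n] assoc_mult_mat[of _ n n _ n _ n])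
  ultimately show ?thesis
    using a x y by (intro eq_matI) auto
qed

section \<open>Rings generated by the identity\<close>

text \<open>
  The additive subgroup generated by \<open>1\<close>, whose equality with the whole ring is the common
  feature of the finite rings generated by \<open>1\<close> and of the ring of integers.
\<close>
inductive_set multiples_of_one :: "'a::{ring, monoid_mult} set" where
  zero: "0 \<in> multiples_of_one"
| add: "x \<in> multiples_of_one \<Longrightarrow> x + 1 \<in> multiples_of_one"
| diff: "x \<in> multiples_of_one \<Longrightarrow> x - 1 \<in> multiples_of_one"

lemma multiples_of_one_commute:
  fixes s :: "'a::{ring, monoid_mult}"
  assumes "r \<in> multiples_of_one"
  shows "r * s = s * r"
  using assms by induction (simp_all add: algebra_simps)

lemma multiples_of_one_UNIV_finite:
  assumes "finite_ring_generated_by_one TYPE('a::{ring, monoid_mult})"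
  shows "(multiples_of_one :: 'a set) = UNIV"
proof (rule UNIV_eq_I[symmetric])
  fix x :: 'a
  have "(\<Sum>i<k. 1) \<in> (multiples_of_one :: 'a set)" for k :: nat
    by (induction k) (auto simp: add.commute[of 1] intro: multiples_of_one.intros)
  then show "x \<in> multiples_of_one"
    using assms unfolding finite_ring_generated_by_one_def by metis
qed

lemma multiples_of_one_UNIV_integers:
  assumes "ring_of_integers TYPE('a::{ring, monoid_mult})"
  shows "(multiples_of_one :: 'a set) = UNIV"
proof (rule UNIV_eq_I[symmetric])
  fix x :: 'a
  obtain f :: "'a \<Rightarrow> int" where f: "bij f" "f 1 = 1" and add: "\<And>x y. f (x + y) = f x + f y"
    using assms unfolding ring_of_integers_def by blast
  have f0: "f 0 = 0" using add[of 0 0] by simp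
  have diff: "f (x - y) = f x - f y" for x y
    using add[of "x - y" y] by simp
  have "\<exists>r \<in> multiples_of_one. f r = m" for m
  proof (induction m rule: int_induct[where k = 0])
    case base
    then show ?case using f0 multiples_of_one.zero by blast
  next
    case (step1 m)
    then show ?case using f add multiples_of_one.add by metis
  next
    case (step2 m)
    then show ?case using f diff multiples_of_one.diff by metis
  qed
  then show "x \<in> multiples_of_one"
    using f(1) by (metis bij_is_inj injD)
qed

text \<open>
  If every entry is an integer multiple of \<open>1\<close>, the matrix units generate the additive group of
  matrices: a single entry is reached by induction on the multiple, and a matrix by adding its
  entries one at a time.
\<close>
lemma mat_additive_induct [consumes 2, case_names zero units add minus]:
  fixes x :: "'a::{ring, monoid_mult} mat"
  assumes gen: "(multiples_of_one :: 'a set) = UNIV"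
    and x: "x \<in> carrier_mat n n"
    and P0: "P (0\<^sub>m n n)"
    and Pu: "\<And>i j. i < n \<Longrightarrow> j < n \<Longrightarrow> P (matrix_unit n i j)"
    and Padd: "\<And>x y. \<lbrakk>x \<in> carrier_mat n n; y \<in> carrier_mat n n; P x; P y\<rbrakk> \<Longrightarrow> P (x + y)"
    and Pminus: "\<And>x y. \<lbrakk>x \<in> carrier_mat n n; y \<in> carrier_mat n n; P x; P y\<rbrakk> \<Longrightarrow> P (x - y)"
  shows "P x"
proof -
  have entry: "P (r \<cdot>\<^sub>m matrix_unit n i j)" if ij: "i < n" "j < n" for r i j
  proof -
    have "r \<in> multiples_of_one" using gen by simp
    then show ?thesis
    proof induction
      case zero
      have "(0 :: 'a) \<cdot>\<^sub>m matrix_unit n i j = 0\<^sub>m n n"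
        by (intro eq_matI) (auto simp: matrix_unit_def)
      then show ?case using P0 by simp
    next
      case (add r)
      have "(r + 1) \<cdot>\<^sub>m matrix_unit n i j = r \<cdot>\<^sub>m matrix_unit n i j + matrix_unit n i j"
        by (intro eq_matI) (auto simp: matrix_unit_def)
      then show ?case using add Pu[OF ij] by (auto intro: Padd)
    next
      case (diff r)
      have "(r - 1) \<cdot>\<^sub>m matrix_unit n i j = r \<cdot>\<^sub>m matrix_unit n i j - matrix_unit n i j"
        by (intro eq_matI) (auto simp: matrix_unit_def)
      then show ?case using diff Pu[OF ij] by (auto intro: Pminus)
    qed
  qed
  \<comment> \<open>\<open>cut S\<close> keeps the entries of \<open>x\<close> at the positions in \<open>S\<close>; \<open>S\<close> grows to the full square.\<close>
  define cut where "cut S = mat n n (\<lambda>p. if p \<in> S then x $$ p else 0)" for S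
  have "P (cut S)" if "finite S" "S \<subseteq> {..<n} \<times> {..<n}" for S
    using that
  proof (induction S rule: finite_induct)
    case empty
    have "cut {} = 0\<^sub>m n n"
      unfolding cut_def by (intro eq_matI) auto
    then show ?case using P0 by simp
  next
    case (insert p S)
    obtain i j where p: "p = (i, j)" by (cases p)
    have "cut (insert p S) = cut S + x $$ p \<cdot>\<^sub>m matrix_unit n i j"
      using insert.hyps unfolding cut_def matrix_unit_def p by (intro eq_matI) auto
    moreover have "P (x $$ p \<cdot>\<^sub>m matrix_unit n i j)"
      using insert.prems p by (auto intro: entry)
    moreover have "P (cut S)" using insert by simp
    moreover have "cut S \<in> carrier_mat n n" by (simp add: cut_def)
    ultimately show ?case by (auto intro: Padd)
  qed
  moreover have "cut ({..<n} \<times> {..<n}) = x"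
    unfolding cut_def using x by (intro eq_matI) auto
  ultimately show ?thesis by (metis finite_SigmaI finite_lessThan order_refl)
qed

lemma additive_on_mat_diff:
  fixes f :: "'a::ring mat \<Rightarrow> 'a mat"
  assumes f: "additive_on (carrier_mat n n) f"
    and x: "x \<in> carrier_mat n n" and y: "y \<in> carrier_mat n n"
  shows "f (x - y) = f x - f y"
proof -
  have d: "x - y \<in> carrier_mat n n" using y by (rule minus_carrier_mat)
  have "x - y + y = x" using x y by (intro eq_matI) auto
  then have "f x = f (x - y) + f y"
    using f d y unfolding additive_on_def by metis
  moreover have "f (x - y) \<in> carrier_mat n n" "f y \<in> carrier_mat n n"
    using f d y unfolding additive_on_def by blast+
  ultimately show ?thesis by (intro eq_matI) auto
qed

lemma additive_on_mat_eqI: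
  fixes f g :: "'a::{ring, monoid_mult} mat \<Rightarrow> 'a mat"
  assumes gen: "(multiples_of_one :: 'a set) = UNIV"
    and f: "additive_on (carrier_mat n n) f" and g: "additive_on (carrier_mat n n) g"
    and units: "\<And>i j. \<lbrakk>i < n; j < n\<rbrakk> \<Longrightarrow> f (matrix_unit n i j) = g (matrix_unit n i j)"
    and x: "x \<in> carrier_mat n n"
  shows "f x = g x"
  using gen x
proof (induction rule: mat_additive_induct)
  case zero
  have self_diff: "A - A = 0\<^sub>m n n" if "A \<in> carrier_mat n n" for A :: "'a mat"
    using that by (intro eq_matI) auto
  have "h (0\<^sub>m n n) = 0\<^sub>m n n" if h: "additive_on (carrier_mat n n) h" for h :: "'a mat \<Rightarrow> 'a mat"
  proof -
    have "h (0\<^sub>m n n) \<in> carrier_mat n n"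
      using h zero_carrier_mat unfolding additive_on_def by blast
    then show ?thesis
      using additive_on_mat_diff[OF h, of "0\<^sub>m n n" "0\<^sub>m n n"] by (simp add: self_diff)
  qed
  from this[OF f] this[OF g] show ?case by simp
next
  case (units i j)
  then show ?case by (rule assms(4))
next
  case (add x y)
  then show ?case using f g unfolding additive_on_def by simp
next
  case (minus x y)
  then show ?case using f g by (simp add: additive_on_mat_diff)
qed

section \<open>Local inner derivations\<close>

text \<open>
  The form \<open>tr (\<Delta> x \<cdot> y)\<close> vanishes on commuting pairs, and by \<open>units_form\<close> it is
  \<open>\<phi> [x, y]\<close> on matrix units. The matrix \<open>a\<close> is chosen so that \<open>tr (a e\<^sub>i\<^sub>l) = \<phi> e\<^sub>i\<^sub>l\<close>, which
  explains the transposed indices in its definition.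
\<close>
lemma local_inner_derivation_inner_on_units:
  fixes \<Delta> :: "'a::{ring, monoid_mult} mat \<Rightarrow> 'a mat"
  assumes comm: "\<And>r s :: 'a. r * s = s * r"
    and local: "local_inner_derivation_on (carrier_mat n n) \<Delta>"
  obtains a where "a \<in> carrier_mat n n"
    and "\<And>i j. \<lbrakk>i < n; j < n\<rbrakk>
      \<Longrightarrow> \<Delta> (matrix_unit n i j) = a * matrix_unit n i j - matrix_unit n i j * a"
proof -
  have carrier: "\<Delta> x \<in> carrier_mat n n" if "x \<in> carrier_mat n n" for x
    using local that unfolding local_inner_derivation_on_def additive_on_def by blast
  have add: "\<Delta> (x + y) = \<Delta> x + \<Delta> y" if "x \<in> carrier_mat n n" "y \<in> carrier_mat n n" for x y
    using local that unfolding local_inner_derivation_on_def additive_on_def by blast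
  define B where "B x y = mat_trace (\<Delta> x * y)" for x y
  interpret lie_null_form n B
  proof
    fix x y z :: "'a mat"
    assume c: "x \<in> carrier_mat n n" "y \<in> carrier_mat n n" "z \<in> carrier_mat n n"
    show "B (x + y) z = B x z + B y z"
      using c carrier[of x] carrier[of y]
      by (simp add: B_def add add_mult_distrib_mat[of _ n n _ _ n] mat_trace_add[of _ n])
    show "B x (y + z) = B x y + B x z"
      using c carrier[of x] by (simp add: B_def mult_add_distrib_mat[of _ n n _ n] mat_trace_add[of _ n])
  next
    fix x y :: "'a mat"
    assume c: "x \<in> carrier_mat n n" "y \<in> carrier_mat n n" "x * y = y * x"
    obtain a where "a \<in> carrier_mat n n" "\<Delta> x = a * x - x * a"
      using local c unfolding local_inner_derivation_on_def inner_derivation_def by blast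
    then show "B x y = 0"
      unfolding B_def using c by (simp add: mat_trace_commutator_mult[of _ n] comm)
  qed
  define a where "a = mat n n (\<lambda>(l, i). coeff i l)"
  have a: "a \<in> carrier_mat n n" by (simp add: a_def)
  show ?thesis
  proof
    fix i j assume ij: "i < n" "j < n"
    show "\<Delta> (matrix_unit n i j) = a * matrix_unit n i j - matrix_unit n i j * a"
    proof (rule eq_matI)
      fix l k
      assume "l < dim_row (a * matrix_unit n i j - matrix_unit n i j * a)"
        and "k < dim_col (a * matrix_unit n i j - matrix_unit n i j * a)"
      then have lk: "l < n" "k < n"
        using a by (auto simp: matrix_unit_def)
      have "\<Delta> (matrix_unit n i j) $$ (l, k) = B (matrix_unit n i j) (matrix_unit n k l)"
        using lk carrier by (simp add: B_def mat_trace_mult_matrix_unit)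
      also have "\<dots> = (if j = k then coeff i l else 0) - (if l = i then coeff k j else 0)"
        by (rule units_form[OF ij lk(2) lk(1)])
      also have "\<dots> = (a * matrix_unit n i j) $$ (l, k) - (matrix_unit n i j * a) $$ (l, k)"
        using ij lk a
        by (simp add: index_mult_matrix_unit index_matrix_unit_mult del: index_mult_mat(1))
          (auto simp: a_def)
      also have "\<dots> = (a * matrix_unit n i j - matrix_unit n i j * a) $$ (l, k)"
        using lk a by (simp add: matrix_unit_def)
      finally show "\<Delta> (matrix_unit n i j) $$ (l, k)
          = (a * matrix_unit n i j - matrix_unit n i j * a) $$ (l, k)" .
    qed (use a carrier[OF matrix_unit_carrier] in \<open>auto simp: matrix_unit_def\<close>)
  qed (rule a)
qed

theorem theorem2p16:
  fixes n :: nat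
    and \<Delta> :: "'a::{ring, monoid_mult} mat \<Rightarrow> 'a mat"
  assumes "finite_ring_generated_by_one TYPE('a) \<or> ring_of_integers TYPE('a)"
    and "n > 1"
    and "local_inner_derivation_on (carrier_mat n n) \<Delta>"
  shows "(\<exists>a \<in> carrier_mat n n. \<forall>x \<in> carrier_mat n n. \<Delta> x = a * x - x * a) \<and>
         derivation_on (carrier_mat n n) \<Delta>"
proof -
  have gen: "(multiples_of_one :: 'a set) = UNIV"
    using assms(1) multiples_of_one_UNIV_finite multiples_of_one_UNIV_integers by blast
  have comm: "r * s = s * r" for r s :: 'a
    using multiples_of_one_commute gen by blast
  have additive: "additive_on (carrier_mat n n) \<Delta>"
    using assms(3) unfolding local_inner_derivation_on_def by blast
  obtain a where a: "a \<in> carrier_mat n n"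
    and units: "\<And>i j. \<lbrakk>i < n; j < n\<rbrakk>
      \<Longrightarrow> \<Delta> (matrix_unit n i j) = a * matrix_unit n i j - matrix_unit n i j * a"
    using local_inner_derivation_inner_on_units[OF comm assms(3)] by blast
  have "additive_on (carrier_mat n n) (\<lambda>x. a * x - x * a)"
    unfolding additive_on_def using a by (auto simp: minus_carrier_mat intro: commutator_add_right)
  then have inner: "\<Delta> x = a * x - x * a" if "x \<in> carrier_mat n n" for x
    using additive_on_mat_eqI[OF gen additive _ units that] by blast
  then have "derivation_on (carrier_mat n n) \<Delta>"
    unfolding derivation_on_def using a additive commutator_leibniz[of a n] by simp
  then show ?thesis using a inner by blast
qed

end
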